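(* Let $(V,E)$ be a finite electrical network with edge parameters $L_{xy},D_{xy},R_{xy}$, let $s\in\mathbb{C}$ with $\operatorname{Re} s>0$, and let $\widetilde\Delta_\rho$ be the associated normalized complex-weighted Laplacian. Then the following hold. (i) Every eigenvalue of $\widetilde\Delta_\rho$ with positive imaginary part lies in the closed disc in $\mathbb{C}\cong\mathbb{R}^2$ with center $\left(1,\frac{|\operatorname{Im}s|}{\operatorname{Re}s}\right)$ and radius $\sqrt{1+\left(\frac{\operatorname{Im}s}{\operatorname{Re}s}\right)^2}$. (ii) Every eigenvalue of $\widetilde\Delta_\rho$ with negative imaginary part lies in the closed disc with center $\left(1,-\frac{|\operatorname{Im}s|}{\operatorname{Re}s}\right)$ and radius $\sqrt{1+\left(\frac{\operatorname{Im}s}{\operatorname{Re}s}\right)^2}$. (iii) Every real eigenvalue of $\widetilde\Delta_\rho$ lies in $[0,2]$.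
   Context: A finite electrical network consists of a finite nonempty vertex set $V$ and a set $E$ of undirected edges $xy$ without loops. Each edge $xy$ carries non-negative real numbers $L_{xy},D_{xy},R_{xy}$ (symmetric in $x,y$) with $L_{xy}+D_{xy}+R_{xy}>0$. Every vertex is incident to at least one edge. For fixed $s\in\mathbb{C}$ with $\operatorname{Re}s>0$, the admittance of an edge $xy$ is $$\rho_{xy}=\frac{s}{L_{xy}s^2+R_{xy}s+D_{xy}},$$ and $\rho_{xy}=0$ if $xy$ is not an edge. Put $\rho(x)=\sum_{y\in V}\rho_{xy}$. The normalized complex-weighted Laplacian acts on functions $f:V\to\mathbb{C}$ by $$\widetilde\Delta_\rho f(x)=f(x)-\frac{1}{\rho(x)}\sum_{y\in V}f(y)\rho_{xy}.$$ (For $\operatorname{Re}s>0$ the denominators in $\rho_{xy}$ are nonzero and $\rho(x)\neq 0$, so this is well defined.) *)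

theory Defs
  imports "HOL-Analysis.Analysis"
begin

text \<open>
  Edges are two-element subsets of the vertex set; the edge parameters are functions of the two
  end points, and only their values on edges are constrained and used.
\<close>

locale finite_electrical_network =
  fixes V :: "'a set"
    and E :: "'a set set"
    and L D R :: "'a \<Rightarrow> 'a \<Rightarrow> real"
  assumes finite_V: "finite V"
    and V_nonempty: "V \<noteq> {}"
    and edgeD: "e \<in> E \<Longrightarrow> \<exists>x\<in>V. \<exists>y\<in>V. x \<noteq> y \<and> e = {x, y}"
    and incident: "x \<in> V \<Longrightarrow> \<exists>e\<in>E. x \<in> e"
    and L_sym: "{x, y} \<in> E \<Longrightarrow> L x y = L y x"
    and D_sym: "{x, y} \<in> E \<Longrightarrow> D x y = D y x"
    and R_sym: "{x, y} \<in> E \<Longrightarrow> R x y = R y x"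
    and L_nonneg: "{x, y} \<in> E \<Longrightarrow> 0 \<le> L x y"
    and D_nonneg: "{x, y} \<in> E \<Longrightarrow> 0 \<le> D x y"
    and R_nonneg: "{x, y} \<in> E \<Longrightarrow> 0 \<le> R x y"
    and LDR_pos: "{x, y} \<in> E \<Longrightarrow> 0 < L x y + D x y + R x y"

definition admittance ::
  "'a set set \<Rightarrow> ('a \<Rightarrow> 'a \<Rightarrow> real) \<Rightarrow> ('a \<Rightarrow> 'a \<Rightarrow> real) \<Rightarrow> ('a \<Rightarrow> 'a \<Rightarrow> real) \<Rightarrow> complex \<Rightarrow>
    'a \<Rightarrow> 'a \<Rightarrow> complex" where
  "admittance E L D R s x y =
    (if {x, y} \<in> E
     then s / (of_real (L x y) * s\<^sup>2 + of_real (R x y) * s + of_real (D x y))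
     else 0)"

definition vertex_weight :: "'a set \<Rightarrow> ('a \<Rightarrow> 'a \<Rightarrow> complex) \<Rightarrow> 'a \<Rightarrow> complex" where
  "vertex_weight V \<rho> x = (\<Sum>y\<in>V. \<rho> x y)"

definition normalized_laplacian ::
  "'a set \<Rightarrow> ('a \<Rightarrow> 'a \<Rightarrow> complex) \<Rightarrow> ('a \<Rightarrow> complex) \<Rightarrow> 'a \<Rightarrow> complex" where
  "normalized_laplacian V \<rho> f x =
    f x - 1 / vertex_weight V \<rho> x * (\<Sum>y\<in>V. f y * \<rho> x y)"

text \<open>
  A function on \<open>V\<close> is represented by a total function whose values outside \<open>V\<close> are
  irrelevant; hence an eigenfunction must be nonzero somewhere on \<open>V\<close>, and the eigenvalue
  equation is required on \<open>V\<close> only. This is meaningful for operators \<open>T\<close> such that \<open>T f\<close> on \<open>V\<close>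
  depends only on \<open>f\<close> on \<open>V\<close>, see \<open>normalized_laplacian_cong\<close> below.
\<close>

definition eigenvalue_on ::
  "'a set \<Rightarrow> (('a \<Rightarrow> complex) \<Rightarrow> 'a \<Rightarrow> complex) \<Rightarrow> complex \<Rightarrow> bool" where
  "eigenvalue_on V T \<mu> \<longleftrightarrow>
    (\<exists>f. (\<exists>x\<in>V. f x \<noteq> 0) \<and> (\<forall>x\<in>V. T f x = \<mu> * f x))"

lemma normalized_laplacian_cong:
  assumes "\<And>x. x \<in> V \<Longrightarrow> f x = g x" and "x \<in> V"
  shows "normalized_laplacian V \<rho> f x = normalized_laplacian V \<rho> g x"
  using assms by (simp add: normalized_laplacian_def cong: sum.cong)

text \<open>Under the standing assumptions, neither of the two divisions above is by zero.\<close>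

context finite_electrical_network
begin

lemma impedance_Re_pos:
  assumes "{x, y} \<in> E" and s: "Re s > 0"
  shows "0 < Re (of_real (L x y) * s + of_real (R x y) + of_real (D x y) / s)"
proof -
  define q where "q = Re s / ((Re s)\<^sup>2 + (Im s)\<^sup>2)"
  have "0 < (Re s)\<^sup>2 + (Im s)\<^sup>2"
    using s by (simp add: add_pos_nonneg)
  then have q: "0 < q"
    using s by (simp add: q_def)
  have eq: "Re (of_real (L x y) * s + of_real (R x y) + of_real (D x y) / s)
      = L x y * Re s + R x y + D x y * q"
    by (simp add: Re_divide q_def)
  have nonneg: "0 \<le> L x y" "0 \<le> R x y" "0 \<le> D x y"
    using assms L_nonneg R_nonneg D_nonneg by auto
  then have prods: "0 \<le> L x y * Re s" "0 \<le> D x y * q"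
    using s q by auto
  consider "0 < L x y" | "0 < R x y" | "0 < D x y"
    using LDR_pos[OF assms(1)] nonneg by linarith
  then show ?thesis
  proof cases
    case 1
    then have "0 < L x y * Re s" using s by simp
    then show ?thesis using eq prods nonneg by linarith
  next
    case 2
    then show ?thesis using eq prods by linarith
  next
    case 3
    then have "0 < D x y * q" using q by simp
    then show ?thesis using eq prods nonneg by linarith
  qed
qed

lemma denominator_factor:
  assumes "Re s > 0"
  shows "of_real (L x y) * s\<^sup>2 + of_real (R x y) * s + of_real (D x y)
    = s * (of_real (L x y) * s + of_real (R x y) + of_real (D x y) / s)"
proof -
  have "s \<noteq> 0" using assms by auto
  then show ?thesis by (simp add: field_simps power2_eq_square)
qed

lemma denominator_nonzero:
  assumes "{x, y} \<in> E" and "Re s > 0"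
  shows "of_real (L x y) * s\<^sup>2 + of_real (R x y) * s + of_real (D x y) \<noteq> 0"
proof -
  have "of_real (L x y) * s + of_real (R x y) + of_real (D x y) / s \<noteq> 0"
    using impedance_Re_pos[OF assms] by (metis less_irrefl zero_complex.sel(1))
  moreover have "s \<noteq> 0" using assms(2) by auto
  ultimately show ?thesis
    unfolding denominator_factor[OF assms(2)] by simp
qed

lemma admittance_Re_pos:
  assumes "{x, y} \<in> E" and s: "Re s > 0"
  shows "0 < Re (admittance E L D R s x y)"
proof -
  define z where "z = of_real (L x y) * s + of_real (R x y) + of_real (D x y) / s"
  have z: "0 < Re z" using impedance_Re_pos[OF assms] by (simp add: z_def)
  have "s \<noteq> 0" using s by auto
  then have "admittance E L D R s x y = 1 / z"
    using assms(1) denominator_factor[OF s, of x y] by (simp add: admittance_def z_def)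
  moreover have "0 < (Re z)\<^sup>2 + (Im z)\<^sup>2"
    using z by (simp add: add_pos_nonneg)
  ultimately show ?thesis using z by (simp add: Re_divide)
qed

lemma vertex_weight_nonzero:
  assumes "x \<in> V" and s: "Re s > 0"
  shows "vertex_weight V (admittance E L D R s) x \<noteq> 0"
proof -
  obtain e where e: "e \<in> E" "x \<in> e" using incident[OF assms(1)] by blast
  obtain a b where ab: "a \<in> V" "b \<in> V" "e = {a, b}"
    using edgeD[OF e(1)] by blast
  obtain y where y: "y \<in> V" "{x, y} \<in> E"
    using e ab by (metis doubleton_eq_iff insertE singletonD)
  have "0 < (\<Sum>v\<in>V. Re (admittance E L D R s x v))"
  proof (rule sum_pos2[OF finite_V y(1)])
    show "0 < Re (admittance E L D R s x y)"
      by (rule admittance_Re_pos[OF y(2) s])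
  next
    show "0 \<le> Re (admittance E L D R s x v)" for v
      using admittance_Re_pos[of x v s] s by (cases "{x, v} \<in> E") (auto simp: admittance_def)
  qed
  then have "0 < Re (vertex_weight V (admittance E L D R s) x)"
    by (simp add: vertex_weight_def)
  then show ?thesis by auto
qed

end

end

theory Submission
  imports Defs
begin

text \<open>
  All admittances lie in the sector $|\mathrm{Im}\, z| \le t\, \mathrm{Re}\, z$ with
  $t = |\mathrm{Im}\, s| / \mathrm{Re}\, s$. If $\mu$ has eigenfunction $f$, put
  $A = \sum_x \rho(x) |f(x)|^2$, a nonzero element of the sector. Pairing the eigenvalue equation
  with $f$ and symmetrizing gives
  $2 \mu A = \sum_{x,y} \rho_{xy} |f(x) - f(y)|^2$ and
  $2 (2 - \mu) A = \sum_{x,y} \rho_{xy} |f(x) + f(y)|^2$, so both $\mu A$ and $(2 - \mu) A$ lie in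
  the sector as well. For elements $b, c$ of the sector one has
  $\mathrm{Re}(b \bar c) + t\, |\mathrm{Im}(b \bar c)| \ge 0$, which for $b = \mu A$ and
  $c = (2 - \mu) A$ becomes
  $|\mu|^2 \le 2\, \mathrm{Re}\, \mu + 2 t\, |\mathrm{Im}\, \mu|$, and this contains all three claims.
\<close>

text \<open>For $t = 0$ this is the whole real line, so $\mathrm{Re}\, z \ge 0$ has to be tracked separately.\<close>

definition sector :: "real \<Rightarrow> complex set" where
  "sector t = {z. \<bar>Im z\<bar> \<le> t * Re z}"

text \<open>Together with \<open>sector_add\<close> and \<open>sector_scale\<close> this makes each
  sector a convex cone; the estimate is the triangle inequality.\<close>

lemma sector_sum:
  assumes "\<And>i. i \<in> I \<Longrightarrow> g i \<in> sector t"
  shows "sum g I \<in> sector t"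
proof -
  have "\<bar>\<Sum>i\<in>I. Im (g i)\<bar> \<le> (\<Sum>i\<in>I. t * Re (g i))"
    using assms by (intro order.trans[OF sum_abs] sum_mono) (auto simp: sector_def)
  then show ?thesis
    by (simp add: sector_def sum_distrib_left)
qed

lemma sector_add:
  assumes "z \<in> sector t" and "w \<in> sector t"
  shows "z + w \<in> sector t"
  using assms by (auto simp: sector_def distrib_left)

lemma sector_scale:
  assumes "z \<in> sector t" and "0 \<le> r"
  shows "z * of_real r \<in> sector t"
  using mult_right_mono[of "\<bar>Im z\<bar>" "t * Re z" r] assms
  by (simp add: sector_def abs_mult mult.assoc)

text \<open>The inverse is the conjugate divided by the squared modulus, and the sector is invariant
  under conjugation and nonnegative scaling. At 0 the convention \<open>inverse 0 = 0\<close>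
  fits.\<close>

lemma sector_inverse:
  assumes "z \<in> sector t"
  shows "inverse z \<in> sector t"
  using divide_right_mono[of "\<bar>Im z\<bar>" "t * Re z" "(Re z)\<^sup>2 + (Im z)\<^sup>2"] assms
  by (simp add: sector_def)

lemma sector_pairing:
  assumes b: "b \<in> sector t" and c: "c \<in> sector t"
    and b0: "0 \<le> Re b" and c0: "0 \<le> Re c" and t: "0 \<le> t"
  shows "0 \<le> Re (b * cnj c) + t * \<bar>Im (b * cnj c)\<bar>"
proof -
  have re: "Re (b * cnj c) = Re b * Re c + Im b * Im c"
    and im: "Im (b * cnj c) = Im b * Re c - Re b * Im c"
    by (auto simp: algebra_simps)
  have rr: "0 \<le> Re b * Re c"
    using b0 c0 by simp
  show ?thesis
  proof (cases "0 \<le> Im b * Im c")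
    case True
    then show ?thesis
      using rr t unfolding re by simp
  next
    \<comment> \<open>The imaginary parts now have strictly opposite signs, so the two terms of
      \<open>Im (b * cnj c)\<close> do not cancel, and its modulus is at least
      \<open>\<bar>Im b\<bar> * Re c\<close>. Membership of \<open>c\<close> in the sector turns
      this into a bound for the negative term of \<open>Re (b * cnj c)\<close>.\<close>
    case False
    have "\<bar>Im b * Im c\<bar> \<le> \<bar>Im b\<bar> * (t * Re c)"
      unfolding abs_mult using c by (intro mult_left_mono) (auto simp: sector_def)
    also have "\<dots> = t * (\<bar>Im b\<bar> * Re c)"
      by simp
    also have "\<bar>Im b\<bar> * Re c \<le> \<bar>Im (b * cnj c)\<bar>"
    proof -
      consider "0 < Im b" "Im c < 0" | "Im b < 0" "0 < Im c"
        using False by (auto simp: not_le mult_less_0_iff)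
      then show ?thesis
      proof cases
        case 1
        with b0 have "Re b * Im c \<le> 0"
          by (simp add: mult_nonneg_nonpos)
        with 1 show ?thesis
          unfolding im by simp
      next
        case 2
        with b0 have "0 \<le> Re b * Im c"
          by simp
        with 2 show ?thesis
          unfolding im by simp
      qed
    qed
    finally show ?thesis
      using rr t unfolding re by (auto simp: mult_left_mono)
  qed
qed

text \<open>The condition on \<open>c\<close> covers both signs at once: -1 gives the energy of
  differences, 1 its counterpart with sums. After expanding the square, exchanging x and y
  identifies the two diagonal sums, and likewise the two cross sums.\<close>

lemma quadratic_form_symmetrize:
  fixes w :: "'a \<Rightarrow> 'a \<Rightarrow> complex" and f :: "'a \<Rightarrow> complex" and c :: real
  assumes sym: "\<And>x y. w x y = w y x" and c: "c\<^sup>2 = 1"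
  shows "(\<Sum>x\<in>V. \<Sum>y\<in>V. w x y * of_real ((cmod (f x + of_real c * f y))\<^sup>2))
    = 2 * (\<Sum>x\<in>V. (\<Sum>y\<in>V. w x y) * of_real ((cmod (f x))\<^sup>2))
      + 2 * of_real c * (\<Sum>x\<in>V. cnj (f x) * (\<Sum>y\<in>V. f y * w x y))"
proof -
  let ?A = "\<Sum>x\<in>V. \<Sum>y\<in>V. w x y * (f x * cnj (f x))"
  let ?B = "\<Sum>x\<in>V. \<Sum>y\<in>V. w x y * (f y * cnj (f x))"
  have c': "complex_of_real c * complex_of_real c = 1"
    using c by (metis of_real_1 of_real_mult power2_eq_square)
  have expand: "w x y * of_real ((cmod (f x + of_real c * f y))\<^sup>2)
      = w x y * (f x * cnj (f x)) + w x y * (f y * cnj (f y))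
        + of_real c * (w x y * (f y * cnj (f x))) + of_real c * (w x y * (f x * cnj (f y)))" for x y
  proof -
    have "complex_of_real ((cmod (f x + of_real c * f y))\<^sup>2)
        = f x * cnj (f x) + (of_real c * of_real c) * (f y * cnj (f y))
          + of_real c * (f y * cnj (f x)) + of_real c * (f x * cnj (f y))"
      by (simp only: complex_norm_square) (simp add: algebra_simps)
    then show ?thesis
      unfolding c' by (simp add: algebra_simps)
  qed
  have A': "(\<Sum>x\<in>V. \<Sum>y\<in>V. w x y * (f y * cnj (f y))) = ?A"
    by (subst sum.swap, subst sym) (rule refl)
  have B': "(\<Sum>x\<in>V. \<Sum>y\<in>V. w x y * (f x * cnj (f y))) = ?B"
    by (subst sum.swap, subst sym) (rule refl)
  have "(\<Sum>x\<in>V. \<Sum>y\<in>V. w x y * of_real ((cmod (f x + of_real c * f y))\<^sup>2))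
      = ?A + ?A + of_real c * ?B + of_real c * ?B"
    unfolding expand sum.distrib sum_distrib_left[symmetric] A' B' ..
  moreover have "(\<Sum>x\<in>V. (\<Sum>y\<in>V. w x y) * of_real ((cmod (f x))\<^sup>2)) = ?A"
    by (simp only: complex_norm_square sum_distrib_right)
  moreover have "(\<Sum>x\<in>V. cnj (f x) * (\<Sum>y\<in>V. f y * w x y)) = ?B"
    by (simp add: sum_distrib_left mult_ac)
  ultimately show ?thesis
    by (simp add: algebra_simps)
qed

context finite_electrical_network
begin

lemma admittance_sym: "admittance E L D R s x y = admittance E L D R s y x"
  using L_sym[of x y] D_sym[of x y] R_sym[of x y]
  by (simp add: admittance_def insert_commute)

lemma admittance_Re_nonneg:
  assumes "Re s > 0"
  shows "0 \<le> Re (admittance E L D R s x y)"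
  using admittance_Re_pos[of x y s] assms
  by (cases "{x, y} \<in> E") (auto simp: admittance_def)

text \<open>On an edge the admittance is the inverse of the impedance \<open>z\<close>, a
  nonnegative combination of s, 1 and 1/s. The slope of the sector is chosen so that s lies on its
  boundary.\<close>

lemma admittance_sector:
  assumes s: "Re s > 0"
  shows "admittance E L D R s x y \<in> sector (\<bar>Im s\<bar> / Re s)"
proof (cases "{x, y} \<in> E")
  case True
  let ?t = "\<bar>Im s\<bar> / Re s"
  define z where "z = s * of_real (L x y) + of_real (R x y) + inverse s * of_real (D x y)"
  have nonneg: "0 \<le> L x y" "0 \<le> R x y" "0 \<le> D x y"
    using True L_nonneg R_nonneg D_nonneg by auto
  have ss: "s \<in> sector ?t"
    using s by (simp add: sector_def)
  have "of_real (R x y) \<in> sector ?t"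
    using nonneg s by (simp add: sector_def)
  moreover have "s * of_real (L x y) \<in> sector ?t" "inverse s * of_real (D x y) \<in> sector ?t"
    using ss nonneg by (auto intro: sector_scale sector_inverse)
  ultimately have "z \<in> sector ?t"
    unfolding z_def by (intro sector_add)
  moreover have "admittance E L D R s x y = inverse z"
  proof -
    have "s \<noteq> 0"
      using s by auto
    then show ?thesis
      using True denominator_factor[OF s, of x y]
      by (simp add: admittance_def z_def divide_inverse mult_ac)
  qed
  ultimately show ?thesis
    by (simp add: sector_inverse)
next
  case False
  then show ?thesis
    by (simp add: admittance_def sector_def)
qed

text \<open>This makes the weighted norm nonzero, so that it can be cancelled from inequalities
  later.\<close>

lemma weighted_norm_Re_pos:
  assumes s: "Re s > 0" and f: "x\<^sub>0 \<in> V" "f x\<^sub>0 \<noteq> (0::complex)"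
  shows "0 < Re (\<Sum>x\<in>V. vertex_weight V (admittance E L D R s) x * of_real ((cmod (f x))\<^sup>2))"
proof -
  let ?W = "vertex_weight V (admittance E L D R s)"
  have nonneg: "0 \<le> Re (?W x)" for x
    unfolding vertex_weight_def using admittance_Re_nonneg[OF s] by (simp add: sum_nonneg)
  have "?W x\<^sub>0 \<in> sector (\<bar>Im s\<bar> / Re s)"
    unfolding vertex_weight_def by (intro sector_sum admittance_sector s)
  \<comment> \<open>In the sector a vanishing real part forces the imaginary part to vanish
    too.\<close>
  with vertex_weight_nonzero[OF f(1) s] have "Re (?W x\<^sub>0) \<noteq> 0"
    by (auto simp: sector_def complex_eq_iff)
  with nonneg[of x\<^sub>0] have "0 < Re (?W x\<^sub>0)"
    by simp
  then have "0 < (\<Sum>x\<in>V. Re (?W x) * (cmod (f x))\<^sup>2)"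
    using f nonneg by (intro sum_pos2[OF finite_V f(1)]) auto
  then show ?thesis
    by (simp flip: of_real_power)
qed

lemma eigenvalue_bound:
  assumes s: "Re s > 0"
    and ev: "eigenvalue_on V (normalized_laplacian V (admittance E L D R s)) \<mu>"
  shows "(cmod \<mu>)\<^sup>2 \<le> 2 * Re \<mu> + 2 * (\<bar>Im s\<bar> / Re s) * \<bar>Im \<mu>\<bar>"
proof -
  define \<rho> where "\<rho> = admittance E L D R s"
  define t where "t = \<bar>Im s\<bar> / Re s"
  have t0: "0 \<le> t"
    using s by (simp add: t_def)
  obtain f x\<^sub>0 where x0: "x\<^sub>0 \<in> V" "f x\<^sub>0 \<noteq> 0"
    and eq: "\<And>x. x \<in> V \<Longrightarrow> normalized_laplacian V \<rho> f x = \<mu> * f x"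
    using ev unfolding eigenvalue_on_def \<rho>_def by blast
  define A where "A = (\<Sum>x\<in>V. vertex_weight V \<rho> x * of_real ((cmod (f x))\<^sup>2))"
  have A: "0 < Re A"
    using weighted_norm_Re_pos[where f = f, OF s x0] by (simp add: A_def \<rho>_def)
  have row: "(\<Sum>y\<in>V. f y * \<rho> x y) = (1 - \<mu>) * (vertex_weight V \<rho> x * f x)" if "x \<in> V" for x
  proof -
    have "vertex_weight V \<rho> x \<noteq> 0"
      using vertex_weight_nonzero[OF that s] by (simp add: \<rho>_def)
    then show ?thesis
      using eq[OF that] by (simp add: normalized_laplacian_def field_simps)
  qed
  have pair: "(\<Sum>x\<in>V. cnj (f x) * (\<Sum>y\<in>V. f y * \<rho> x y)) = (1 - \<mu>) * A"
    unfolding A_def sum_distrib_left[of "1 - \<mu>"]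
    by (intro sum.cong refl, subst row) (simp_all only: complex_norm_square mult_ac)
  \<comment> \<open>The factor \<open>1 + of_real c * (1 - \<mu>)\<close> is \<mu> for c = -1 and 2
    - \<mu> for c = 1.\<close>
  have form: "(\<Sum>x\<in>V. \<Sum>y\<in>V. \<rho> x y * of_real ((cmod (f x + of_real c * f y))\<^sup>2))
      = 2 * ((1 + of_real c * (1 - \<mu>)) * A)" if "c\<^sup>2 = 1" for c
  proof -
    have "\<rho> x y = \<rho> y x" for x y
      unfolding \<rho>_def by (rule admittance_sym)
    from quadratic_form_symmetrize[of \<rho> _ f V, OF this that] show ?thesis
      unfolding pair vertex_weight_def[symmetric] A_def[symmetric] by (simp add: algebra_simps)
  qed
  have cone: "(1 + of_real c * (1 - \<mu>)) * A \<in> sector t"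
      "0 \<le> Re ((1 + of_real c * (1 - \<mu>)) * A)" if "c\<^sup>2 = 1" for c
  proof -
    have "2 * ((1 + of_real c * (1 - \<mu>)) * A) \<in> sector t"
      unfolding form[OF that, symmetric] t_def \<rho>_def
      by (intro sector_sum sector_scale admittance_sector s zero_le_power2)
    from sector_scale[OF this, of "1 / 2"] show "(1 + of_real c * (1 - \<mu>)) * A \<in> sector t"
      by simp
    have "0 \<le> Re (2 * ((1 + of_real c * (1 - \<mu>)) * A))"
      unfolding form[OF that, symmetric] Re_sum \<rho>_def
      by (intro sum_nonneg) (simp add: admittance_Re_nonneg[OF s] flip: of_real_power)
    then show "0 \<le> Re ((1 + of_real c * (1 - \<mu>)) * A)"
      by simp
  qed
  have "\<mu> * A \<in> sector t" "0 \<le> Re (\<mu> * A)" "(2 - \<mu>) * A \<in> sector t" "0 \<le> Re ((2 - \<mu>) * A)"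
    using cone[of "-1"] cone[of 1] by simp_all
  then have "0 \<le> Re (\<mu> * A * cnj ((2 - \<mu>) * A)) + t * \<bar>Im (\<mu> * A * cnj ((2 - \<mu>) * A))\<bar>"
    using t0 by (intro sector_pairing)
  \<comment> \<open>Conjugating one factor removes the unknown argument of \<open>A\<close>: only
    its squared modulus remains, a positive real that can be divided out.\<close>
  also have "\<mu> * A * cnj ((2 - \<mu>) * A) = (\<mu> * cnj (2 - \<mu>)) * of_real ((cmod A)\<^sup>2)"
    by (simp only: complex_norm_square complex_cnj_mult mult_ac)
  also have "Re \<dots> + t * \<bar>Im \<dots>\<bar>
      = (cmod A)\<^sup>2 * (Re (\<mu> * cnj (2 - \<mu>)) + t * \<bar>Im (\<mu> * cnj (2 - \<mu>))\<bar>)"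
    by (simp add: abs_mult algebra_simps flip: of_real_power)
  finally have "0 \<le> Re (\<mu> * cnj (2 - \<mu>)) + t * \<bar>Im (\<mu> * cnj (2 - \<mu>))\<bar>"
    using A by (auto simp: zero_le_mult_iff)
  moreover have "Re (\<mu> * cnj (2 - \<mu>)) = 2 * Re \<mu> - (cmod \<mu>)\<^sup>2"
    and "Im (\<mu> * cnj (2 - \<mu>)) = 2 * Im \<mu>"
    unfolding cmod_power2 by (auto simp: power2_eq_square algebra_simps)
  ultimately show ?thesis
    by (simp add: t_def abs_mult mult_ac)
qed

end

text \<open>The bounding circle passes through 0 and 2, so the constant terms cancel when the
  distance inequality is squared and expanded.\<close>

lemma mem_cball_through_0_and_2:
  "\<mu> \<in> cball (Complex 1 h) (sqrt (1 + h\<^sup>2)) \<longleftrightarrow> (cmod \<mu>)\<^sup>2 \<le> 2 * Re \<mu> + 2 * h * Im \<mu>"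
proof -
  have "\<mu> \<in> cball (Complex 1 h) (sqrt (1 + h\<^sup>2)) \<longleftrightarrow> (1 - Re \<mu>)\<^sup>2 + (h - Im \<mu>)\<^sup>2 \<le> 1 + h\<^sup>2"
    by (simp add: dist_norm cmod_def)
  also have "\<dots> \<longleftrightarrow> (cmod \<mu>)\<^sup>2 \<le> 2 * Re \<mu> + 2 * h * Im \<mu>"
    by (auto simp: cmod_power2 power2_diff)
  finally show ?thesis .
qed

theorem theorem2:
  fixes V :: "'a set" and E :: "'a set set"
    and L D R :: "'a \<Rightarrow> 'a \<Rightarrow> real" and s :: complex
  assumes "finite_electrical_network V E L D R"
    and "Re s > 0"
  shows "(\<forall>\<mu>. eigenvalue_on V (normalized_laplacian V (admittance E L D R s)) \<mu> \<and> Im \<mu> > 0 \<longrightarrow>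
            \<mu> \<in> cball (Complex 1 (\<bar>Im s\<bar> / Re s)) (sqrt (1 + (Im s / Re s)\<^sup>2)))
       \<and> (\<forall>\<mu>. eigenvalue_on V (normalized_laplacian V (admittance E L D R s)) \<mu> \<and> Im \<mu> < 0 \<longrightarrow>
            \<mu> \<in> cball (Complex 1 (- (\<bar>Im s\<bar> / Re s))) (sqrt (1 + (Im s / Re s)\<^sup>2)))
       \<and> (\<forall>\<mu>. eigenvalue_on V (normalized_laplacian V (admittance E L D R s)) \<mu> \<and> \<mu> \<in> \<real> \<longrightarrow>
            \<mu> \<in> complex_of_real ` {0..2})"
proof -
  interpret finite_electrical_network V E L D R
    by fact
  let ?ev = "eigenvalue_on V (normalized_laplacian V (admittance E L D R s))"
  note bound = eigenvalue_bound[OF assms(2)]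
  \<comment> \<open>The height h of the center takes the sign of the imaginary part of \<mu>, so h
    times that part is the absolute-value term of \<open>eigenvalue_bound\<close>.\<close>
  have r: "(Im s / Re s)\<^sup>2 = (\<bar>Im s\<bar> / Re s)\<^sup>2" "(Im s / Re s)\<^sup>2 = (- (\<bar>Im s\<bar> / Re s))\<^sup>2"
    by (simp_all add: power_divide)
  have "\<mu> \<in> cball (Complex 1 (\<bar>Im s\<bar> / Re s)) (sqrt (1 + (Im s / Re s)\<^sup>2))"
    if "?ev \<mu>" "Im \<mu> > 0" for \<mu>
    unfolding r(1) mem_cball_through_0_and_2 using bound[OF that(1)] that(2) by simp
  moreover have "\<mu> \<in> cball (Complex 1 (- (\<bar>Im s\<bar> / Re s))) (sqrt (1 + (Im s / Re s)\<^sup>2))"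
    if "?ev \<mu>" "Im \<mu> < 0" for \<mu>
    unfolding r(2) mem_cball_through_0_and_2 using bound[OF that(1)] that(2) by simp
  moreover have "\<mu> \<in> complex_of_real ` {0..2}" if "?ev \<mu>" "\<mu> \<in> \<real>" for \<mu>
  proof -
    obtain a where a: "\<mu> = of_real a"
      using \<open>\<mu> \<in> \<real>\<close> by (rule Reals_cases)
    have "a * a \<le> 2 * a"
      using bound[OF \<open>?ev \<mu>\<close>] by (simp add: a power2_eq_square)
    then have "0 \<le> a * (2 - a)"
      by (simp add: algebra_simps)
    then have "a \<in> {0..2}"
      by (auto simp: zero_le_mult_iff)
    then show ?thesis
      by (simp add: a)
  qed
  ultimately show ?thesis
    by blast
qed

end
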